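(* Let $\mathcal{C}$ be a category which is preregular and finitary extensive. Then $\mathcal{C}$ is precoherent.
   Context: A morphism $f\colon Y\to X$ is an effective epimorphism if for every $e\colon Y\to W$ such that $e\circ g_1=e\circ g_2$ for all $g_1,g_2\colon Z\to Y$ with $f\circ g_1=f\circ g_2$, there is a unique $d\colon X\to W$ with $d\circ f=e$. A family of morphisms $(f_i\colon X_i\to B)_{i\in I}$ is effective epimorphic if for every object $W$ and every family $(e_i\colon X_i\to W)_{i\in I}$ such that $e_i\circ g_i=e_j\circ g_j$ whenever $i,j\in I$, $g_i\colon Z\to X_i$, $g_j\colon Z\to X_j$ satisfy $f_i\circ g_i=f_j\circ g_j$, there is a unique $d\colon B\to W$ with $d\circ f_i=e_i$ for all $i$. A category is preregular if for every effective epimorphism $g\colon Z\to Y$ and every morphism $f\colon X\to Y$ there exist an effective epimorphism $h\colon W\to X$ and a morphism $i\colon W\to Z$ with $g\circ i=f\circ h$. A category is finitary extensive if it has finite coproducts, it has pullbacks along coprojections of finite coproducts, and for every commutative diagram with top row $Z_1\to Z\leftarrow Z_2$, bottom row the coprojections $X\to X\coprod Y\leftarrow Y$, and vertical maps $Z_1\to X$, $Z\to X\coprod Y$, $Z_2\to Y$, both squares are pullbacks if and only if the top row is a coproduct diagram. A category is precoherent if for every finite effective epimorphic family $(\pi_i\colon X_i\to B)_{i\in I}$ and every morphism $f\colon B'\to B$ there is a finite effective epimorphic family $(\pi'_j\colon X'_j\to B')_{j\in J}$ such that each $f\circ\pi'_j$ factors through some $\pi_i$. *)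

theory Defs
  imports Main
begin

section \<open>Categories\<close>

record ('o, 'm) cat_data =
  Obj :: "'o set"
  Arr :: "'m set"
  Dom :: "'m \<Rightarrow> 'o"
  Cod :: "'m \<Rightarrow> 'o"
  Id :: "'o \<Rightarrow> 'm"
  Comp :: "'m \<Rightarrow> 'm \<Rightarrow> 'm" (infixl "\<cdot>\<index>" 70)

text \<open>Composition is written in the usual order: \<open>g \<cdot>\<^bsub>C\<^esub> f\<close> means first \<open>f\<close>, then \<open>g\<close>. Its value on
  pairs of arrows that are not composable is left unspecified.\<close>

definition hom :: "('o, 'm) cat_data \<Rightarrow> 'o \<Rightarrow> 'o \<Rightarrow> 'm set" where
  "hom C X Y = {f \<in> Arr C. Dom C f = X \<and> Cod C f = Y}"

locale category =
  fixes C :: "('o, 'm) cat_data" (structure)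
  assumes Dom_Obj: "f \<in> Arr C \<Longrightarrow> Dom C f \<in> Obj C"
    and Cod_Obj: "f \<in> Arr C \<Longrightarrow> Cod C f \<in> Obj C"
    and Id_hom: "X \<in> Obj C \<Longrightarrow> Id C X \<in> hom C X X"
    and Comp_hom: "f \<in> hom C X Y \<Longrightarrow> g \<in> hom C Y Z \<Longrightarrow> g \<cdot> f \<in> hom C X Z"
    and Comp_Id: "f \<in> hom C X Y \<Longrightarrow> f \<cdot> Id C X = f"
    and Id_Comp: "f \<in> hom C X Y \<Longrightarrow> Id C Y \<cdot> f = f"
    and Comp_assoc: "f \<in> hom C W X \<Longrightarrow> g \<in> hom C X Y \<Longrightarrow> h \<in> hom C Y Z \<Longrightarrow>
      (h \<cdot> g) \<cdot> f = h \<cdot> (g \<cdot> f)"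


section \<open>Effective epimorphisms\<close>

definition effective_epi :: "('o, 'm) cat_data \<Rightarrow> 'm \<Rightarrow> bool" where
  "effective_epi C f \<longleftrightarrow> f \<in> Arr C \<and>
    (\<forall>W \<in> Obj C. \<forall>e \<in> hom C (Dom C f) W.
      (\<forall>Z \<in> Obj C. \<forall>g1 \<in> hom C Z (Dom C f). \<forall>g2 \<in> hom C Z (Dom C f).
        f \<cdot>\<^bsub>C\<^esub> g1 = f \<cdot>\<^bsub>C\<^esub> g2 \<longrightarrow> e \<cdot>\<^bsub>C\<^esub> g1 = e \<cdot>\<^bsub>C\<^esub> g2) \<longrightarrow>
      (\<exists>!d. d \<in> hom C (Cod C f) W \<and> d \<cdot>\<^bsub>C\<^esub> f = e))"

text \<open>A family of morphisms \<open>f i : X i \<rightarrow> B\<close> is given by an index set \<open>I\<close>, the function \<open>f\<close>, of which only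
  the values on \<open>I\<close> matter, and the common codomain \<open>B\<close>, which has to be an argument because \<open>I\<close> may
  be empty; the objects \<open>X i\<close> are the domains of the \<open>f i\<close>.\<close>

definition arrow_family :: "('o, 'm) cat_data \<Rightarrow> 'i set \<Rightarrow> ('i \<Rightarrow> 'm) \<Rightarrow> 'o \<Rightarrow> bool" where
  "arrow_family C I f B \<longleftrightarrow> B \<in> Obj C \<and> (\<forall>i \<in> I. f i \<in> Arr C \<and> Cod C (f i) = B)"

definition effective_epi_family ::
    "('o, 'm) cat_data \<Rightarrow> 'i set \<Rightarrow> ('i \<Rightarrow> 'm) \<Rightarrow> 'o \<Rightarrow> bool" where
  "effective_epi_family C I f B \<longleftrightarrow> arrow_family C I f B \<and>
    (\<forall>W \<in> Obj C. \<forall>e. (\<forall>i \<in> I. e i \<in> hom C (Dom C (f i)) W) \<longrightarrow>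
      (\<forall>i \<in> I. \<forall>j \<in> I. \<forall>Z \<in> Obj C. \<forall>gi \<in> hom C Z (Dom C (f i)). \<forall>gj \<in> hom C Z (Dom C (f j)).
        f i \<cdot>\<^bsub>C\<^esub> gi = f j \<cdot>\<^bsub>C\<^esub> gj \<longrightarrow> e i \<cdot>\<^bsub>C\<^esub> gi = e j \<cdot>\<^bsub>C\<^esub> gj) \<longrightarrow>
      (\<exists>!d. d \<in> hom C B W \<and> (\<forall>i \<in> I. d \<cdot>\<^bsub>C\<^esub> f i = e i)))"


section \<open>Coproducts and pullbacks\<close>

definition is_coproduct :: "('o, 'm) cat_data \<Rightarrow> 'i set \<Rightarrow> ('i \<Rightarrow> 'm) \<Rightarrow> 'o \<Rightarrow> bool" where
  "is_coproduct C I \<iota> S \<longleftrightarrow> arrow_family C I \<iota> S \<and>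
    (\<forall>W \<in> Obj C. \<forall>e. (\<forall>i \<in> I. e i \<in> hom C (Dom C (\<iota> i)) W) \<longrightarrow>
      (\<exists>!d. d \<in> hom C S W \<and> (\<forall>i \<in> I. d \<cdot>\<^bsub>C\<^esub> \<iota> i = e i)))"

text \<open>The diagram \<open>X \<rightarrow> S \<leftarrow> Y\<close> with arrows \<open>\<iota>1\<close> and \<open>\<iota>2\<close> is a coproduct diagram.\<close>

definition is_binary_coproduct :: "('o, 'm) cat_data \<Rightarrow> 'm \<Rightarrow> 'm \<Rightarrow> 'o \<Rightarrow> bool" where
  "is_binary_coproduct C \<iota>1 \<iota>2 S \<longleftrightarrow> is_coproduct C UNIV (\<lambda>b. if b then \<iota>1 else \<iota>2) S"

text \<open>Here and below, finite families are indexed by finite sets of natural numbers, which loses no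
  generality as every finite set is in bijection with one of these. The empty family is included.\<close>

definition has_finite_coproducts :: "('o, 'm) cat_data \<Rightarrow> bool" where
  "has_finite_coproducts C \<longleftrightarrow>
    (\<forall>(I :: nat set) X. finite I \<longrightarrow> (\<forall>i \<in> I. X i \<in> Obj C) \<longrightarrow>
      (\<exists>\<iota> S. is_coproduct C I \<iota> S \<and> (\<forall>i \<in> I. Dom C (\<iota> i) = X i)))"

text \<open>The pullback square has the projections \<open>p : P \<rightarrow> A\<close>, \<open>q : P \<rightarrow> B\<close> over the cospan \<open>f : A \<rightarrow> S\<close>,
  \<open>g : B \<rightarrow> S\<close>.\<close>

definition is_pullback :: "('o, 'm) cat_data \<Rightarrow> 'm \<Rightarrow> 'm \<Rightarrow> 'm \<Rightarrow> 'm \<Rightarrow> bool" where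
  "is_pullback C p q f g \<longleftrightarrow>
    p \<in> Arr C \<and> q \<in> Arr C \<and> f \<in> Arr C \<and> g \<in> Arr C \<and>
    Dom C p = Dom C q \<and> Cod C p = Dom C f \<and> Cod C q = Dom C g \<and> Cod C f = Cod C g \<and>
    f \<cdot>\<^bsub>C\<^esub> p = g \<cdot>\<^bsub>C\<^esub> q \<and>
    (\<forall>T \<in> Obj C. \<forall>a \<in> hom C T (Dom C f). \<forall>b \<in> hom C T (Dom C g). f \<cdot>\<^bsub>C\<^esub> a = g \<cdot>\<^bsub>C\<^esub> b \<longrightarrow>
      (\<exists>!u. u \<in> hom C T (Dom C p) \<and> p \<cdot>\<^bsub>C\<^esub> u = a \<and> q \<cdot>\<^bsub>C\<^esub> u = b))"

definition has_pullbacks_along_coprojections :: "('o, 'm) cat_data \<Rightarrow> bool" where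
  "has_pullbacks_along_coprojections C \<longleftrightarrow>
    (\<forall>(I :: nat set) \<iota> S. finite I \<longrightarrow> is_coproduct C I \<iota> S \<longrightarrow>
      (\<forall>i \<in> I. \<forall>f \<in> Arr C. Cod C f = S \<longrightarrow> (\<exists>p q. is_pullback C p q (\<iota> i) f)))"


section \<open>Preregular, finitary extensive and precoherent categories\<close>

definition preregular :: "('o, 'm) cat_data \<Rightarrow> bool" where
  "preregular C \<longleftrightarrow>
    (\<forall>X \<in> Obj C. \<forall>Y \<in> Obj C. \<forall>Z \<in> Obj C. \<forall>g \<in> hom C Z Y. \<forall>f \<in> hom C X Y. effective_epi C g \<longrightarrow>
      (\<exists>W \<in> Obj C. \<exists>h \<in> hom C W X. \<exists>i \<in> hom C W Z. effective_epi C h \<and> g \<cdot>\<^bsub>C\<^esub> i = f \<cdot>\<^bsub>C\<^esub> h))"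

text \<open>In the last clause, the diagram is
  \<open>z1 : Z1 \<rightarrow> Z\<close>, \<open>z2 : Z2 \<rightarrow> Z\<close> (top row), \<open>\<iota>1 : X \<rightarrow> S\<close>, \<open>\<iota>2 : Y \<rightarrow> S\<close> (bottom row), and
  \<open>a : Z1 \<rightarrow> X\<close>, \<open>h : Z \<rightarrow> S\<close>, \<open>b : Z2 \<rightarrow> Y\<close> (vertical). As coproducts are only determined up to
  isomorphism, \<open>S\<close> ranges over all coproducts of \<open>X\<close> and \<open>Y\<close>.\<close>

definition finitary_extensive :: "('o, 'm) cat_data \<Rightarrow> bool" where
  "finitary_extensive C \<longleftrightarrow>
    has_finite_coproducts C \<and>
    has_pullbacks_along_coprojections C \<and>
    (\<forall>X \<in> Obj C. \<forall>Y \<in> Obj C. \<forall>S \<in> Obj C. \<forall>Z1 \<in> Obj C. \<forall>Z \<in> Obj C. \<forall>Z2 \<in> Obj C.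
      \<forall>\<iota>1 \<in> hom C X S. \<forall>\<iota>2 \<in> hom C Y S. \<forall>z1 \<in> hom C Z1 Z. \<forall>z2 \<in> hom C Z2 Z.
      \<forall>a \<in> hom C Z1 X. \<forall>h \<in> hom C Z S. \<forall>b \<in> hom C Z2 Y.
        is_binary_coproduct C \<iota>1 \<iota>2 S \<longrightarrow> \<iota>1 \<cdot>\<^bsub>C\<^esub> a = h \<cdot>\<^bsub>C\<^esub> z1 \<longrightarrow> \<iota>2 \<cdot>\<^bsub>C\<^esub> b = h \<cdot>\<^bsub>C\<^esub> z2 \<longrightarrow>
          (is_pullback C a z1 \<iota>1 h \<and> is_pullback C b z2 \<iota>2 h \<longleftrightarrow> is_binary_coproduct C z1 z2 Z))"

definition precoherent :: "('o, 'm) cat_data \<Rightarrow> bool" where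
  "precoherent C \<longleftrightarrow>
    (\<forall>(I :: nat set) \<pi>. \<forall>B \<in> Obj C. \<forall>B' \<in> Obj C. \<forall>f \<in> hom C B' B.
      finite I \<longrightarrow> effective_epi_family C I \<pi> B \<longrightarrow>
      (\<exists>(J :: nat set) \<pi>'. finite J \<and> effective_epi_family C J \<pi>' B' \<and>
        (\<forall>j \<in> J. \<exists>i \<in> I. \<exists>k \<in> hom C (Dom C (\<pi>' j)) (Dom C (\<pi> i)). f \<cdot>\<^bsub>C\<^esub> \<pi>' j = \<pi> i \<cdot>\<^bsub>C\<^esub> k)))"

end

theory Submission
  imports Defs
begin

text \<open>
  A finite effective epimorphic family \<open>\<pi> i : X i \<rightarrow> B\<close> is first replaced by a single effective
  epimorphism: the induced morphism \<open>p : S \<rightarrow> B\<close> out of the coproduct \<open>S\<close> of the \<open>X i\<close> is one, because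
  data on \<open>S\<close> compatible with \<open>p\<close> restricts to data on the \<open>X i\<close> compatible with the family
  (\<open>effective_epi_copairing\<close>). Given \<open>f : B' \<rightarrow> B\<close>, preregularity yields an effective epimorphism
  \<open>h : W \<rightarrow> B'\<close> and \<open>k : W \<rightarrow> S\<close> with \<open>p \<cdot> k = f \<cdot> h\<close>. Extensivity says that the decomposition of
  \<open>S\<close> into the \<open>X i\<close> pulls back along \<open>k\<close> to a decomposition of \<open>W\<close> into objects \<open>W i\<close> with coprojections
  \<open>q i : W i \<rightarrow> W\<close> (\<open>coproduct_decomposition\<close>). The family \<open>h \<cdot> q i\<close> is the required cover of
  \<open>B'\<close>: it factors through the \<open>\<pi> i\<close> over \<open>f\<close> since \<open>k \<cdot> q i\<close> factors through \<open>X i\<close>.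

  It remains to see that splitting the domain of an effective epimorphism \<open>h\<close> into a finite coproduct
  gives an effective epimorphic family (\<open>effective_epi_family_of_coproduct\<close>), and this is the second use
  of extensivity. Compatible data on the \<open>W i\<close> glue to some \<open>e : W \<rightarrow> T\<close>. To compare \<open>e \<cdot> g1\<close> with
  \<open>e \<cdot> g2\<close> when \<open>h \<cdot> g1 = h \<cdot> g2\<close>, the common domain of \<open>g1\<close> and \<open>g2\<close> is decomposed along \<open>g1\<close>, and
  each piece again along \<open>g2\<close>. On every resulting piece \<open>g1\<close> lands in one \<open>W i\<close> and \<open>g2\<close> in one
  \<open>W j\<close>, where the compatibility of the data applies.
\<close>

section \<open>Coproducts\<close>

context category
begin

lemma homD:
  assumes "f \<in> hom C X Y"
  shows "f \<in> Arr C" "Dom C f = X" "Cod C f = Y" "X \<in> Obj C" "Y \<in> Obj C"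
  using assms Dom_Obj Cod_Obj by (auto simp: hom_def)

lemma coprojection_hom:
  assumes "is_coproduct C I \<iota> S" "i \<in> I"
  shows "\<iota> i \<in> hom C (Dom C (\<iota> i)) S"
  using assms by (auto simp: is_coproduct_def arrow_family_def hom_def)

lemma is_coproductI:
  assumes "S \<in> Obj C" "\<And>i. i \<in> I \<Longrightarrow> \<iota> i \<in> hom C (X i) S"
    and "\<And>W e. W \<in> Obj C \<Longrightarrow> (\<And>i. i \<in> I \<Longrightarrow> e i \<in> hom C (X i) W) \<Longrightarrow>
      \<exists>d. d \<in> hom C S W \<and> (\<forall>i \<in> I. d \<cdot> \<iota> i = e i)"
    and "\<And>W d d'. d \<in> hom C S W \<Longrightarrow> d' \<in> hom C S W \<Longrightarrow>
      (\<And>i. i \<in> I \<Longrightarrow> d \<cdot> \<iota> i = d' \<cdot> \<iota> i) \<Longrightarrow> d = d'"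
  shows "is_coproduct C I \<iota> S"
  unfolding is_coproduct_def
proof (intro conjI ballI allI impI)
  show "arrow_family C I \<iota> S"
    using assms(1,2) by (auto simp: arrow_family_def hom_def)
next
  fix W e assume W: "W \<in> Obj C" and e: "\<forall>i \<in> I. e i \<in> hom C (Dom C (\<iota> i)) W"
  have "\<exists>d. d \<in> hom C S W \<and> (\<forall>i \<in> I. d \<cdot> \<iota> i = e i)"
    using assms(3)[OF W] e assms(2) homD(2) by metis
  then show "\<exists>!d. d \<in> hom C S W \<and> (\<forall>i \<in> I. d \<cdot> \<iota> i = e i)"
    using assms(4) by metis
qed

lemma coproduct_copair:
  assumes "is_coproduct C I \<iota> S" "W \<in> Obj C"
    and "\<And>i. i \<in> I \<Longrightarrow> e i \<in> hom C (Dom C (\<iota> i)) W"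
  obtains d where "d \<in> hom C S W" "\<And>i. i \<in> I \<Longrightarrow> d \<cdot> \<iota> i = e i"
  using assms unfolding is_coproduct_def by metis

lemma coproduct_jointly_epic:
  assumes S: "is_coproduct C I \<iota> S" and d: "d \<in> hom C S W" and d': "d' \<in> hom C S W"
    and eq: "\<And>i. i \<in> I \<Longrightarrow> d \<cdot> \<iota> i = d' \<cdot> \<iota> i"
  shows "d = d'"
proof -
  have "\<forall>i \<in> I. d' \<cdot> \<iota> i \<in> hom C (Dom C (\<iota> i)) W"
    using Comp_hom[OF coprojection_hom[OF S] d'] by blast
  then have "\<exists>!x. x \<in> hom C S W \<and> (\<forall>i \<in> I. x \<cdot> \<iota> i = d' \<cdot> \<iota> i)"
    using S[unfolded is_coproduct_def, THEN conjunct2, rule_format, OF homD(5)[OF d],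
        of "\<lambda>i. d' \<cdot> \<iota> i"] by simp
  then show ?thesis
    using d d' eq by blast
qed

lemma finite_coproduct:
  fixes I :: "nat set"
  assumes "finitary_extensive C" "finite I" "\<And>i. i \<in> I \<Longrightarrow> X i \<in> Obj C"
  obtains \<iota> S where "is_coproduct C I \<iota> S" "\<And>i. i \<in> I \<Longrightarrow> Dom C (\<iota> i) = X i"
proof -
  have "has_finite_coproducts C" using assms(1) by (simp add: finitary_extensive_def)
  then have "\<exists>\<iota> S. is_coproduct C I \<iota> S \<and> (\<forall>i \<in> I. Dom C (\<iota> i) = X i)"
    unfolding has_finite_coproducts_def using assms(2,3) by simp
  then show ?thesis using that by blast
qed

lemma is_binary_coproductI:
  assumes "u \<in> hom C X S" "v \<in> hom C Y S"
    and "\<And>W a b. a \<in> hom C X W \<Longrightarrow> b \<in> hom C Y W \<Longrightarrow>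
      \<exists>d. d \<in> hom C S W \<and> d \<cdot> u = a \<and> d \<cdot> v = b"
    and "\<And>W d d'. d \<in> hom C S W \<Longrightarrow> d' \<in> hom C S W \<Longrightarrow>
      d \<cdot> u = d' \<cdot> u \<Longrightarrow> d \<cdot> v = d' \<cdot> v \<Longrightarrow> d = d'"
  shows "is_binary_coproduct C u v S"
  unfolding is_binary_coproduct_def
proof (rule is_coproductI[where X = "\<lambda>b. if b then X else Y"])
  show "S \<in> Obj C" using assms(1) homD by blast
  show "(if b then u else v) \<in> hom C (if b then X else Y) S" for b
    using assms(1,2) by simp
  show "\<exists>d. d \<in> hom C S W \<and> (\<forall>i \<in> UNIV. d \<cdot> (if i then u else v) = e i)"
    if "\<And>i. i \<in> UNIV \<Longrightarrow> e i \<in> hom C (if i then X else Y) W" for W e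
    using assms(3)[of "e True" W "e False"] that[of True] that[of False] by (simp add: all_bool_eq)
  show "d = d'" if "d \<in> hom C S W" "d' \<in> hom C S W"
    "\<And>i. i \<in> UNIV \<Longrightarrow> d \<cdot> (if i then u else v) = d' \<cdot> (if i then u else v)" for W d d'
    using assms(4)[OF that(1,2)] that(3)[of True] that(3)[of False] by simp
qed

lemma binary_coproduct_hom:
  assumes "is_binary_coproduct C u v S"
  shows "u \<in> hom C (Dom C u) S" "v \<in> hom C (Dom C v) S"
  using coprojection_hom[OF assms[unfolded is_binary_coproduct_def], of True]
    coprojection_hom[OF assms[unfolded is_binary_coproduct_def], of False] by simp_all

lemma binary_coproduct_copair:
  assumes "is_binary_coproduct C u v S" "a \<in> hom C (Dom C u) W" "b \<in> hom C (Dom C v) W"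
  obtains d where "d \<in> hom C S W" "d \<cdot> u = a" "d \<cdot> v = b"
proof -
  obtain d where d: "d \<in> hom C S W"
    "\<And>i. i \<in> UNIV \<Longrightarrow> d \<cdot> (if i then u else v) = (if i then a else b)"
    using assms(1)[unfolded is_binary_coproduct_def] homD(5)[OF assms(2)]
    by (rule coproduct_copair[where e = "\<lambda>i. if i then a else b"])
      (use assms(2,3) in auto)
  show ?thesis using that[OF d(1)] d(2)[of True] d(2)[of False] by simp
qed

lemma binary_coproduct_jointly_epic:
  assumes "is_binary_coproduct C u v S" "d \<in> hom C S W" "d' \<in> hom C S W"
    and "d \<cdot> u = d' \<cdot> u" "d \<cdot> v = d' \<cdot> v"
  shows "d = d'"
  using assms(1)[unfolded is_binary_coproduct_def] assms(2,3)
  by (rule coproduct_jointly_epic) (simp add: assms(4,5))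

text \<open>This transports binary coproducts to the natural number indices over which pullbacks along
  coprojections are postulated.\<close>

lemma binary_coproduct_as_family:
  assumes S: "is_binary_coproduct C u v S"
  shows "is_coproduct C {0, 1 :: nat} (\<lambda>i. if i = 0 then u else v) S"
proof (rule is_coproductI[where X = "\<lambda>i. if i = 0 then Dom C u else Dom C v"])
  show "S \<in> Obj C" using binary_coproduct_hom(1)[OF S] homD by blast
  show "(if i = 0 then u else v) \<in> hom C (if i = 0 then Dom C u else Dom C v) S" for i :: nat
    using binary_coproduct_hom[OF S] by simp
  show "\<exists>d. d \<in> hom C S W \<and> (\<forall>i \<in> {0, 1 :: nat}. d \<cdot> (if i = 0 then u else v) = e i)"
    if "\<And>i. i \<in> {0, 1 :: nat} \<Longrightarrow> e i \<in> hom C (if i = 0 then Dom C u else Dom C v) W" for W e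
    using binary_coproduct_copair[OF S, of "e 0" W "e 1"] that[of 0] that[of 1] by auto
  show "d = d'" if "d \<in> hom C S W" "d' \<in> hom C S W"
    "\<And>i. i \<in> {0, 1 :: nat} \<Longrightarrow> d \<cdot> (if i = 0 then u else v) = d' \<cdot> (if i = 0 then u else v)"
    for W d d'
    using binary_coproduct_jointly_epic[OF S that(1,2)] that(3)[of 0] that(3)[of 1] by simp
qed

text \<open>The next two lemmas are the associativity of coproducts, \<open>\<Coprod>\<^bsub>insert i I\<^esub> X = X i \<Coprod> (\<Coprod>\<^bsub>I\<^esub> X)\<close>,
  read in both directions; they carry the induction that passes from binary to finite coproducts.\<close>

lemma binary_coproduct_of_insert:
  assumes S: "is_coproduct C (insert i I) \<iota> S" and S': "is_coproduct C I \<kappa> S'" and "i \<notin> I"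
    and dom: "\<And>j. j \<in> I \<Longrightarrow> Dom C (\<kappa> j) = Dom C (\<iota> j)"
    and s: "s \<in> hom C S' S" "\<And>j. j \<in> I \<Longrightarrow> s \<cdot> \<kappa> j = \<iota> j"
  shows "is_binary_coproduct C (\<iota> i) s S"
proof (rule is_binary_coproductI)
  show "\<iota> i \<in> hom C (Dom C (\<iota> i)) S" using coprojection_hom[OF S] by simp
  show "s \<in> hom C S' S" by (rule s)
next
  fix W a b assume a: "a \<in> hom C (Dom C (\<iota> i)) W" and b: "b \<in> hom C S' W"
  have "(if j = i then a else b \<cdot> \<kappa> j) \<in> hom C (Dom C (\<iota> j)) W" if "j \<in> insert i I" for j
    using that a Comp_hom[OF coprojection_hom[OF S'] b] dom by auto
  then obtain d where d: "d \<in> hom C S W"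
    "\<And>j. j \<in> insert i I \<Longrightarrow> d \<cdot> \<iota> j = (if j = i then a else b \<cdot> \<kappa> j)"
    using coproduct_copair[OF S homD(5)[OF a], of "\<lambda>j. if j = i then a else b \<cdot> \<kappa> j"] by blast
  have "d \<cdot> s = b"
  proof (rule coproduct_jointly_epic[OF S' Comp_hom[OF s(1) d(1)] b])
    fix j assume j: "j \<in> I"
    have "(d \<cdot> s) \<cdot> \<kappa> j = d \<cdot> \<iota> j"
      using Comp_assoc[OF coprojection_hom[OF S' j] s(1) d(1)] s(2)[OF j] by simp
    also have "\<dots> = b \<cdot> \<kappa> j" using d(2)[of j] j \<open>i \<notin> I\<close> by auto
    finally show "(d \<cdot> s) \<cdot> \<kappa> j = b \<cdot> \<kappa> j" .
  qed
  then show "\<exists>d. d \<in> hom C S W \<and> d \<cdot> \<iota> i = a \<and> d \<cdot> s = b"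
    using d(1) d(2)[of i] by auto
next
  fix W d d' assume d: "d \<in> hom C S W" and d': "d' \<in> hom C S W"
    and eq: "d \<cdot> \<iota> i = d' \<cdot> \<iota> i" "d \<cdot> s = d' \<cdot> s"
  have "d \<cdot> \<iota> j = d' \<cdot> \<iota> j" if j: "j \<in> I" for j
    using Comp_assoc[OF coprojection_hom[OF S' j] s(1) d]
      Comp_assoc[OF coprojection_hom[OF S' j] s(1) d'] s(2)[OF j] eq(2) by simp
  then show "d = d'" using coproduct_jointly_epic[OF S d d'] eq(1) by auto
qed

lemma insert_coproduct_of_binary:
  assumes Z: "is_binary_coproduct C z1 z2 Z" and Z2: "is_coproduct C I q (Dom C z2)"
    and "i \<notin> I"
  shows "is_coproduct C (insert i I) (\<lambda>j. if j = i then z1 else z2 \<cdot> q j) Z"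
proof (rule is_coproductI[where X = "\<lambda>j. if j = i then Dom C z1 else Dom C (q j)"])
  note z1 = binary_coproduct_hom(1)[OF Z] and z2 = binary_coproduct_hom(2)[OF Z]
  show "Z \<in> Obj C" using z1 homD by blast
  show "(if j = i then z1 else z2 \<cdot> q j) \<in> hom C (if j = i then Dom C z1 else Dom C (q j)) Z"
    if "j \<in> insert i I" for j
    using that z1 Comp_hom[OF coprojection_hom[OF Z2] z2] by auto
  show "\<exists>d. d \<in> hom C Z W \<and>
      (\<forall>j \<in> insert i I. d \<cdot> (if j = i then z1 else z2 \<cdot> q j) = e j)"
    if W: "W \<in> Obj C"
      and e: "\<And>j. j \<in> insert i I \<Longrightarrow> e j \<in> hom C (if j = i then Dom C z1 else Dom C (q j)) W"
    for W e
  proof -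
    have "e j \<in> hom C (Dom C (q j)) W" if "j \<in> I" for j
      using e[of j] that \<open>i \<notin> I\<close> by (auto split: if_splits)
    then obtain b where b: "b \<in> hom C (Dom C z2) W" "\<And>j. j \<in> I \<Longrightarrow> b \<cdot> q j = e j"
      using coproduct_copair[OF Z2 W, of e] by blast
    obtain d where d: "d \<in> hom C Z W" "d \<cdot> z1 = e i" "d \<cdot> z2 = b"
      using binary_coproduct_copair[OF Z _ b(1), of "e i"] e[of i] by auto
    have "d \<cdot> (z2 \<cdot> q j) = e j" if "j \<in> I" for j
      using Comp_assoc[OF coprojection_hom[OF Z2 that] z2 d(1)] d(3) b(2)[OF that] by simp
    then show ?thesis using d(1,2) by auto
  qed
  show "d = d'" if d: "d \<in> hom C Z W" and d': "d' \<in> hom C Z W"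
    and eq: "\<And>j. j \<in> insert i I \<Longrightarrow>
      d \<cdot> (if j = i then z1 else z2 \<cdot> q j) = d' \<cdot> (if j = i then z1 else z2 \<cdot> q j)" for W d d'
  proof (rule binary_coproduct_jointly_epic[OF Z d d'])
    show "d \<cdot> z1 = d' \<cdot> z1" using eq[of i] by simp
    show "d \<cdot> z2 = d' \<cdot> z2"
    proof (rule coproduct_jointly_epic[OF Z2 Comp_hom[OF z2 d] Comp_hom[OF z2 d']])
      fix j assume j: "j \<in> I"
      then have "d \<cdot> (z2 \<cdot> q j) = d' \<cdot> (z2 \<cdot> q j)" using eq[of j] \<open>i \<notin> I\<close> by (auto split: if_splits)
      then show "(d \<cdot> z2) \<cdot> q j = (d' \<cdot> z2) \<cdot> q j"
        using Comp_assoc[OF coprojection_hom[OF Z2 j] z2 d]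
          Comp_assoc[OF coprojection_hom[OF Z2 j] z2 d'] by simp
    qed
  qed
qed


section \<open>Decomposition along a coproduct\<close>

lemma pullbackD:
  assumes "is_pullback C p q f g"
  shows "p \<in> hom C (Dom C q) (Dom C f)" "q \<in> hom C (Dom C q) (Dom C g)" "f \<cdot> p = g \<cdot> q"
  using assms by (auto simp: is_pullback_def hom_def)

lemma pullback_of_identity:
  assumes f: "f \<in> hom C Z S"
  shows "is_pullback C f (Id C Z) (Id C S) f"
proof -
  have id: "Id C Z \<in> hom C Z Z" "Id C S \<in> hom C S S"
    using Id_hom homD(4,5)[OF f] by auto
  have "\<exists>!u. u \<in> hom C T Z \<and> f \<cdot> u = a \<and> Id C Z \<cdot> u = b"
    if "a \<in> hom C T S" "b \<in> hom C T Z" "Id C S \<cdot> a = f \<cdot> b" for T a b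
    using that Id_Comp by metis
  then show ?thesis
    unfolding is_pullback_def
    using homD[OF f] homD[OF id(1)] homD[OF id(2)] Comp_Id[OF f] Id_Comp[OF f] by auto
qed

lemma extensive_binary_iff:
  assumes "finitary_extensive C" "is_binary_coproduct C \<iota>1 \<iota>2 S"
    and "\<iota>1 \<in> hom C X S" "\<iota>2 \<in> hom C Y S" "z1 \<in> hom C Z1 Z" "z2 \<in> hom C Z2 Z"
    and "a \<in> hom C Z1 X" "h \<in> hom C Z S" "b \<in> hom C Z2 Y"
    and "\<iota>1 \<cdot> a = h \<cdot> z1" "\<iota>2 \<cdot> b = h \<cdot> z2"
  shows "is_pullback C a z1 \<iota>1 h \<and> is_pullback C b z2 \<iota>2 h \<longleftrightarrow> is_binary_coproduct C z1 z2 Z"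
  using assms(1)[unfolded finitary_extensive_def, THEN conjunct2, THEN conjunct2, rule_format,
      OF homD(4)[OF assms(3)] homD(4)[OF assms(4)] homD(5)[OF assms(3)] homD(4)[OF assms(5)]
        homD(5)[OF assms(5)] homD(4)[OF assms(6)] assms(3-9) assms(2) assms(10,11)] .

text \<open>Initial objects, that is empty coproducts, are strict. An initial \<open>S\<close> is the coproduct of
  \<open>S\<close> and \<open>S\<close> with both coprojections the identity; pulling back along \<open>f : Z \<rightarrow> S\<close> shows the same for
  \<open>Z\<close>, so any two morphisms out of \<open>Z\<close> with the same codomain are equal.\<close>

lemma strict_initial:
  fixes \<iota> \<kappa> :: "'i \<Rightarrow> 'm"
  assumes ext: "finitary_extensive C" and S: "is_coproduct C {} \<iota> S" and f: "f \<in> hom C Z S"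
  shows "is_coproduct C {} \<kappa> Z"
proof (rule is_coproductI)
  show "Z \<in> Obj C" using homD[OF f] by simp
next
  fix W assume "W \<in> Obj C"
  then obtain d where "d \<in> hom C S W" using coproduct_copair[OF S] by blast
  then show "\<exists>d. d \<in> hom C Z W \<and> (\<forall>i \<in> {}. d \<cdot> \<kappa> i = e i)" for e :: "'i \<Rightarrow> 'm"
    using Comp_hom[OF f] by blast
next
  fix W d d' assume d: "d \<in> hom C Z W" and d': "d' \<in> hom C Z W"
  have id: "Id C Z \<in> hom C Z Z" "Id C S \<in> hom C S S"
    using Id_hom homD(4,5)[OF f] by auto
  have bin: "is_binary_coproduct C (Id C S) (Id C S) S"
  proof (rule is_binary_coproductI[OF id(2) id(2)])
    show "\<exists>x. x \<in> hom C S V \<and> x \<cdot> Id C S = a \<and> x \<cdot> Id C S = b"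
      if "a \<in> hom C S V" "b \<in> hom C S V" for V a b
      using coproduct_jointly_epic[OF S that] that Comp_Id by blast
    show "x = x'" if "x \<in> hom C S V" "x' \<in> hom C S V" for V x x'
      using coproduct_jointly_epic[OF S that] by blast
  qed
  have "Id C S \<cdot> f = f \<cdot> Id C Z" using f Comp_Id Id_Comp by simp
  then have "is_binary_coproduct C (Id C Z) (Id C Z) Z"
    using extensive_binary_iff[OF ext bin id(2) id(2) id(1) id(1) f f f]
      pullback_of_identity[OF f] by blast
  then obtain x where "x \<in> hom C Z W" "x \<cdot> Id C Z = d" "x \<cdot> Id C Z = d'"
    using binary_coproduct_copair[of "Id C Z" "Id C Z" Z d W d'] d d' homD(2)[OF id(1)] by metis
  then show "d = d'" by simp
qed auto

lemma binary_coproduct_decomposition: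
  assumes ext: "finitary_extensive C" and S: "is_binary_coproduct C u v S"
    and f: "f \<in> hom C Z S"
  obtains z1 z2 a b where "is_binary_coproduct C z1 z2 Z"
    "a \<in> hom C (Dom C z1) (Dom C u)" "b \<in> hom C (Dom C z2) (Dom C v)"
    "u \<cdot> a = f \<cdot> z1" "v \<cdot> b = f \<cdot> z2"
proof -
  have pb: "\<exists>p q. is_pullback C p q (if i = 0 then u else v) f" if "i \<in> {0, 1 :: nat}" for i
  proof -
    have "has_pullbacks_along_coprojections C" using ext by (simp add: finitary_extensive_def)
    moreover have "finite {0, 1 :: nat}" by simp
    ultimately show ?thesis
      using binary_coproduct_as_family[OF S] that homD(1,3)[OF f]
      unfolding has_pullbacks_along_coprojections_def by blast
  qed
  obtain a z1 where pb1: "is_pullback C a z1 u f" using pb[of 0] by auto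
  obtain b z2 where pb2: "is_pullback C b z2 v f" using pb[of 1] by auto
  note sq1 = pullbackD[OF pb1, unfolded homD(2)[OF f]]
    and sq2 = pullbackD[OF pb2, unfolded homD(2)[OF f]]
  have "is_binary_coproduct C z1 z2 Z"
    using extensive_binary_iff[OF ext S binary_coproduct_hom[OF S] sq1(2) sq2(2) sq1(1) f sq2(1)
        sq1(3) sq2(3)] pb1 pb2 by blast
  then show ?thesis
    using that[of z1 z2 a b] sq1 sq2 homD(2)[OF sq1(2)] homD(2)[OF sq2(2)] by simp
qed

text \<open>The finite form of extensivity: a morphism into a finite coproduct decomposes its domain. The
  induction on the index set splits off one summand at a time; its base case is the strictness of
  initial objects.\<close>

lemma coproduct_decomposition:
  fixes I :: "nat set"
  assumes ext: "finitary_extensive C" and "finite I"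
    and "is_coproduct C I \<iota> S" "f \<in> hom C Z S"
  shows "\<exists>q p. is_coproduct C I q Z \<and>
    (\<forall>i \<in> I. p i \<in> hom C (Dom C (q i)) (Dom C (\<iota> i)) \<and> f \<cdot> q i = \<iota> i \<cdot> p i)"
  using assms(2-)
proof (induction I arbitrary: \<iota> S f Z rule: finite_induct)
  case empty
  then show ?case using strict_initial[OF ext] by blast
next
  case (insert i I)
  note S = insert.prems(1) and f = insert.prems(2)
  have "Dom C (\<iota> j) \<in> Obj C" if "j \<in> I" for j
    using homD(4)[OF coprojection_hom[OF S]] that by blast
  then obtain \<kappa> S' where S': "is_coproduct C I \<kappa> S'"
    and dom: "\<And>j. j \<in> I \<Longrightarrow> Dom C (\<kappa> j) = Dom C (\<iota> j)"
    using finite_coproduct[OF ext insert.hyps(1), of "\<lambda>j. Dom C (\<iota> j)"] by blast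
  have "\<iota> j \<in> hom C (Dom C (\<kappa> j)) S" if "j \<in> I" for j
    using coprojection_hom[OF S] that dom by simp
  then obtain s where s: "s \<in> hom C S' S" "\<And>j. j \<in> I \<Longrightarrow> s \<cdot> \<kappa> j = \<iota> j"
    using coproduct_copair[OF S' homD(5)[OF f], of \<iota>] by blast
  have bin: "is_binary_coproduct C (\<iota> i) s S"
    using binary_coproduct_of_insert[OF S S' insert.hyps(2) dom s] .
  obtain z1 z2 a b where Z: "is_binary_coproduct C z1 z2 Z"
    and a: "a \<in> hom C (Dom C z1) (Dom C (\<iota> i))" and b: "b \<in> hom C (Dom C z2) (Dom C s)"
    and eq: "\<iota> i \<cdot> a = f \<cdot> z1" "s \<cdot> b = f \<cdot> z2"
    using binary_coproduct_decomposition[OF ext bin f] .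
  note z2 = binary_coproduct_hom(2)[OF Z]
  have b': "b \<in> hom C (Dom C z2) S'" using b homD(2)[OF s(1)] by simp
  obtain q p where Z2: "is_coproduct C I q (Dom C z2)"
    and p: "\<And>j. j \<in> I \<Longrightarrow> p j \<in> hom C (Dom C (q j)) (Dom C (\<kappa> j))"
    and bq: "\<And>j. j \<in> I \<Longrightarrow> b \<cdot> q j = \<kappa> j \<cdot> p j"
    using insert.IH[OF S' b'] by blast
  define q' where "q' j = (if j = i then z1 else z2 \<cdot> q j)" for j
  define p' where "p' j = (if j = i then a else p j)" for j
  have "is_coproduct C (insert i I) q' Z"
    unfolding q'_def by (rule insert_coproduct_of_binary[OF Z Z2 insert.hyps(2)])
  moreover have "p' j \<in> hom C (Dom C (q' j)) (Dom C (\<iota> j)) \<and> f \<cdot> q' j = \<iota> j \<cdot> p' j"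
    if "j \<in> insert i I" for j
  proof (cases "j = i")
    case True
    then show ?thesis using a eq(1) by (simp add: q'_def p'_def)
  next
    case False
    then have j: "j \<in> I" using that by simp
    note q = coprojection_hom[OF Z2 j]
    have "f \<cdot> (z2 \<cdot> q j) = (s \<cdot> b) \<cdot> q j"
      using Comp_assoc[OF q z2 f] eq(2) by simp
    also have "\<dots> = s \<cdot> (\<kappa> j \<cdot> p j)"
      using Comp_assoc[OF q b' s(1)] bq[OF j] by simp
    also have "\<dots> = \<iota> j \<cdot> p j"
      using Comp_assoc[OF p[OF j] coprojection_hom[OF S' j] s(1)] s(2)[OF j] by simp
    finally show ?thesis
      using False p[OF j] dom[OF j] homD(2)[OF Comp_hom[OF q z2]] by (simp add: q'_def p'_def)
  qed
  ultimately show ?case by blast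
qed


section \<open>Effective epimorphisms and coproducts\<close>

lemma effective_epi_family_hom:
  assumes "effective_epi_family C I \<pi> B" "i \<in> I"
  shows "\<pi> i \<in> hom C (Dom C (\<pi> i)) B"
  using assms by (auto simp: effective_epi_family_def arrow_family_def hom_def)

text \<open>Compatible data on \<open>S\<close> restricts along the coprojections to compatible data on the family, because
  \<open>\<pi> i \<cdot> gi = \<pi> j \<cdot> gj\<close> says that \<open>p\<close> identifies \<open>\<iota> i \<cdot> gi\<close> and \<open>\<iota> j \<cdot> gj\<close>. The two factorisation
  problems have the same solutions, as the coprojections are jointly epic.\<close>

lemma effective_epi_copairing:
  assumes \<pi>: "effective_epi_family C I \<pi> B" and S: "is_coproduct C I \<iota> S"
    and dom: "\<And>i. i \<in> I \<Longrightarrow> Dom C (\<iota> i) = Dom C (\<pi> i)"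
    and p: "p \<in> hom C S B" "\<And>i. i \<in> I \<Longrightarrow> p \<cdot> \<iota> i = \<pi> i"
  shows "effective_epi C p"
  unfolding effective_epi_def homD(2,3)[OF p(1)]
proof (intro conjI ballI impI)
  show "p \<in> Arr C" using homD[OF p(1)] by simp
next
  fix W e assume W: "W \<in> Obj C" and e: "e \<in> hom C S W"
    and compat: "\<forall>Z \<in> Obj C. \<forall>g1 \<in> hom C Z S. \<forall>g2 \<in> hom C Z S. p \<cdot> g1 = p \<cdot> g2 \<longrightarrow> e \<cdot> g1 = e \<cdot> g2"
  have \<iota>: "\<iota> i \<in> hom C (Dom C (\<pi> i)) S" if "i \<in> I" for i
    using coprojection_hom[OF S that] dom[OF that] by simp
  have "(e \<cdot> \<iota> i) \<cdot> gi = (e \<cdot> \<iota> j) \<cdot> gj"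
    if ij: "i \<in> I" "j \<in> I" and Z: "Z \<in> Obj C"
      and gi: "gi \<in> hom C Z (Dom C (\<pi> i))" and gj: "gj \<in> hom C Z (Dom C (\<pi> j))"
      and eq: "\<pi> i \<cdot> gi = \<pi> j \<cdot> gj" for i j Z gi gj
  proof -
    have "p \<cdot> (\<iota> i \<cdot> gi) = p \<cdot> (\<iota> j \<cdot> gj)"
      using Comp_assoc[OF gi \<iota>[OF ij(1)] p(1)] Comp_assoc[OF gj \<iota>[OF ij(2)] p(1)] p(2) ij eq
      by simp
    then have "e \<cdot> (\<iota> i \<cdot> gi) = e \<cdot> (\<iota> j \<cdot> gj)"
      using compat Z Comp_hom[OF gi \<iota>[OF ij(1)]] Comp_hom[OF gj \<iota>[OF ij(2)]] by blast
    then show ?thesis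
      using Comp_assoc[OF gi \<iota>[OF ij(1)] e] Comp_assoc[OF gj \<iota>[OF ij(2)] e] by simp
  qed
  moreover have "\<forall>i \<in> I. e \<cdot> \<iota> i \<in> hom C (Dom C (\<pi> i)) W"
    using Comp_hom[OF \<iota> e] by blast
  ultimately have ex1: "\<exists>!d. d \<in> hom C B W \<and> (\<forall>i \<in> I. d \<cdot> \<pi> i = e \<cdot> \<iota> i)"
    using \<pi>[unfolded effective_epi_family_def, THEN conjunct2, rule_format, of W "\<lambda>i. e \<cdot> \<iota> i"] W
    by blast
  have "d \<cdot> p = e \<longleftrightarrow> (\<forall>i \<in> I. d \<cdot> \<pi> i = e \<cdot> \<iota> i)" if d: "d \<in> hom C B W" for d
  proof -
    have "(d \<cdot> p) \<cdot> \<iota> i = d \<cdot> \<pi> i" if "i \<in> I" for i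
      using Comp_assoc[OF \<iota>[OF that] p(1) d] p(2)[OF that] by simp
    then show ?thesis
      using coproduct_jointly_epic[OF S Comp_hom[OF p(1) d] e] by auto
  qed
  then show "\<exists>!d. d \<in> hom C B W \<and> d \<cdot> p = e" using ex1 by metis
qed

text \<open>Extensivity detects equality on pieces: the domain \<open>Z\<close> of \<open>g1\<close> and \<open>g2\<close> is covered by pieces on
  which \<open>g1\<close> and \<open>g2\<close> each factor through a single coprojection.\<close>

lemma eq_on_summands:
  fixes I :: "nat set"
  assumes ext: "finitary_extensive C" and fin: "finite I" and W: "is_coproduct C I q W"
    and g: "g1 \<in> hom C Z W" "g2 \<in> hom C Z W" and x: "x \<in> hom C Z T" "y \<in> hom C Z T"
    and pieces: "\<And>i j V z a b. i \<in> I \<Longrightarrow> j \<in> I \<Longrightarrow> z \<in> hom C V Z \<Longrightarrow>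
      a \<in> hom C V (Dom C (q i)) \<Longrightarrow> b \<in> hom C V (Dom C (q j)) \<Longrightarrow>
      g1 \<cdot> z = q i \<cdot> a \<Longrightarrow> g2 \<cdot> z = q j \<cdot> b \<Longrightarrow> x \<cdot> z = y \<cdot> z"
  shows "x = y"
proof -
  obtain r a where Z: "is_coproduct C I r Z"
    and a: "\<And>i. i \<in> I \<Longrightarrow> a i \<in> hom C (Dom C (r i)) (Dom C (q i))"
    and ra: "\<And>i. i \<in> I \<Longrightarrow> g1 \<cdot> r i = q i \<cdot> a i"
    using coproduct_decomposition[OF ext fin W g(1)] by blast
  show ?thesis
  proof (rule coproduct_jointly_epic[OF Z x])
    fix i assume i: "i \<in> I"
    note r = coprojection_hom[OF Z i]
    obtain t b where Zi: "is_coproduct C I t (Dom C (r i))"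
      and b: "\<And>j. j \<in> I \<Longrightarrow> b j \<in> hom C (Dom C (t j)) (Dom C (q j))"
      and tb: "\<And>j. j \<in> I \<Longrightarrow> (g2 \<cdot> r i) \<cdot> t j = q j \<cdot> b j"
      using coproduct_decomposition[OF ext fin W Comp_hom[OF r g(2)]] by blast
    show "x \<cdot> r i = y \<cdot> r i"
    proof (rule coproduct_jointly_epic[OF Zi Comp_hom[OF r x(1)] Comp_hom[OF r x(2)]])
      fix j assume j: "j \<in> I"
      note t = coprojection_hom[OF Zi j]
      have "g1 \<cdot> (r i \<cdot> t j) = q i \<cdot> (a i \<cdot> t j)"
        using Comp_assoc[OF t r g(1)] Comp_assoc[OF t a[OF i] coprojection_hom[OF W i]] ra[OF i]
        by simp
      moreover have "g2 \<cdot> (r i \<cdot> t j) = q j \<cdot> b j"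
        using Comp_assoc[OF t r g(2)] tb[OF j] by simp
      ultimately have "x \<cdot> (r i \<cdot> t j) = y \<cdot> (r i \<cdot> t j)"
        using pieces[OF i j Comp_hom[OF t r] Comp_hom[OF t a[OF i]] b[OF j]] by blast
      then show "(x \<cdot> r i) \<cdot> t j = (y \<cdot> r i) \<cdot> t j"
        using Comp_assoc[OF t r x(1)] Comp_assoc[OF t r x(2)] by simp
    qed
  qed
qed

text \<open>A converse to \<open>effective_epi_copairing\<close>. Here extensivity is essential: it reduces the compatibility
  of the glued morphism, tested against arbitrary \<open>g1, g2 : Z \<rightarrow> W\<close>, to pairs that factor through
  coprojections.\<close>

lemma effective_epi_family_of_coproduct:
  fixes I :: "nat set"
  assumes ext: "finitary_extensive C" and fin: "finite I" and W: "is_coproduct C I q W"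
    and h: "h \<in> hom C W B" "effective_epi C h"
  shows "effective_epi_family C I (\<lambda>i. h \<cdot> q i) B"
proof -
  note q = coprojection_hom[OF W]
  have hq: "h \<cdot> q i \<in> hom C (Dom C (q i)) B" if "i \<in> I" for i
    using Comp_hom[OF q[OF that] h(1)] .
  have dom: "Dom C (h \<cdot> q i) = Dom C (q i)" if "i \<in> I" for i
    using homD(2)[OF hq[OF that]] .
  show ?thesis
    unfolding effective_epi_family_def
  proof (intro conjI ballI allI impI)
    show "arrow_family C I (\<lambda>i. h \<cdot> q i) B"
      unfolding arrow_family_def using homD[OF h(1)] homD[OF hq] by blast
  next
    fix T e assume T: "T \<in> Obj C" and e: "\<forall>i \<in> I. e i \<in> hom C (Dom C (h \<cdot> q i)) T"
      and compat: "\<forall>i \<in> I. \<forall>j \<in> I. \<forall>Z \<in> Obj C. \<forall>gi \<in> hom C Z (Dom C (h \<cdot> q i)).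
        \<forall>gj \<in> hom C Z (Dom C (h \<cdot> q j)). (h \<cdot> q i) \<cdot> gi = (h \<cdot> q j) \<cdot> gj \<longrightarrow> e i \<cdot> gi = e j \<cdot> gj"
    obtain c where c: "c \<in> hom C W T" "\<And>i. i \<in> I \<Longrightarrow> c \<cdot> q i = e i"
      using coproduct_copair[OF W T, of e] e dom by auto
    have "c \<cdot> g1 = c \<cdot> g2"
      if g: "g1 \<in> hom C Z W" "g2 \<in> hom C Z W" and eq: "h \<cdot> g1 = h \<cdot> g2" for Z g1 g2
    proof (rule eq_on_summands[OF ext fin W g Comp_hom[OF g(1) c(1)] Comp_hom[OF g(2) c(1)]])
      fix i j V z a b assume ij: "i \<in> I" "j \<in> I" and z: "z \<in> hom C V Z"
        and a: "a \<in> hom C V (Dom C (q i))" and b: "b \<in> hom C V (Dom C (q j))"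
        and za: "g1 \<cdot> z = q i \<cdot> a" and zb: "g2 \<cdot> z = q j \<cdot> b"
      have "(h \<cdot> q i) \<cdot> a = (h \<cdot> g1) \<cdot> z"
        using Comp_assoc[OF a q[OF ij(1)] h(1)] Comp_assoc[OF z g(1) h(1)] za by simp
      also have "\<dots> = (h \<cdot> q j) \<cdot> b"
        using Comp_assoc[OF b q[OF ij(2)] h(1)] Comp_assoc[OF z g(2) h(1)] zb eq by simp
      finally have "e i \<cdot> a = e j \<cdot> b"
        using compat[rule_format, OF ij homD(4)[OF z]] a b dom[OF ij(1)] dom[OF ij(2)] by metis
      then show "(c \<cdot> g1) \<cdot> z = (c \<cdot> g2) \<cdot> z"
        using Comp_assoc[OF z g(1) c(1)] Comp_assoc[OF z g(2) c(1)] za zb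
          Comp_assoc[OF a q[OF ij(1)] c(1)] Comp_assoc[OF b q[OF ij(2)] c(1)] c(2) ij by simp
    qed
    then have ex1: "\<exists>!d. d \<in> hom C B T \<and> d \<cdot> h = c"
      using h(2)[unfolded effective_epi_def homD(2,3)[OF h(1)]] T c(1) by blast
    have "d \<cdot> h = c \<longleftrightarrow> (\<forall>i \<in> I. d \<cdot> (h \<cdot> q i) = e i)" if d: "d \<in> hom C B T" for d
    proof -
      have "d \<cdot> (h \<cdot> q i) = (d \<cdot> h) \<cdot> q i" if "i \<in> I" for i
        using Comp_assoc[OF q[OF that] h(1) d] by simp
      then show ?thesis
        using coproduct_jointly_epic[OF W Comp_hom[OF h(1) d] c(1)] c(2) by auto
    qed
    then show "\<exists>!d. d \<in> hom C B T \<and> (\<forall>i \<in> I. d \<cdot> (h \<cdot> q i) = e i)" using ex1 by metis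
  qed
qed

end


section \<open>Precoherence\<close>

theorem proposition5p8:
  fixes C :: "('o, 'm) cat_data"
  assumes "category C"
    and "preregular C"
    and "finitary_extensive C"
  shows "precoherent C"
  unfolding precoherent_def
proof (intro allI ballI impI)
  interpret category C by (rule assms(1))
  fix I :: "nat set" and \<pi> B B' f
  assume f: "f \<in> hom C B' B" and fin: "finite I" and \<pi>: "effective_epi_family C I \<pi> B"
  note \<pi>_hom = effective_epi_family_hom[OF \<pi>]
  obtain \<iota> S where S: "is_coproduct C I \<iota> S"
    and dom: "\<And>i. i \<in> I \<Longrightarrow> Dom C (\<iota> i) = Dom C (\<pi> i)"
    using finite_coproduct[OF assms(3) fin, of "\<lambda>i. Dom C (\<pi> i)"] homD(4)[OF \<pi>_hom] by blast
  obtain p where p: "p \<in> hom C S B" "\<And>i. i \<in> I \<Longrightarrow> p \<cdot>\<^bsub>C\<^esub> \<iota> i = \<pi> i"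
    using coproduct_copair[OF S homD(5)[OF f], of \<pi>] \<pi>_hom dom by auto
  obtain W h k where h: "h \<in> hom C W B'" "effective_epi C h" and k: "k \<in> hom C W S"
    and pk: "p \<cdot>\<^bsub>C\<^esub> k = f \<cdot>\<^bsub>C\<^esub> h"
    using assms(2) effective_epi_copairing[OF \<pi> S dom p] p(1) f homD(4,5)[OF p(1)] homD(4)[OF f]
    unfolding preregular_def by blast
  obtain q a where W: "is_coproduct C I q W"
    and a: "\<And>i. i \<in> I \<Longrightarrow> a i \<in> hom C (Dom C (q i)) (Dom C (\<iota> i))"
    and kq: "\<And>i. i \<in> I \<Longrightarrow> k \<cdot>\<^bsub>C\<^esub> q i = \<iota> i \<cdot>\<^bsub>C\<^esub> a i"
    using coproduct_decomposition[OF assms(3) fin S k] by blast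
  have "a i \<in> hom C (Dom C (h \<cdot>\<^bsub>C\<^esub> q i)) (Dom C (\<pi> i)) \<and>
      f \<cdot>\<^bsub>C\<^esub> (h \<cdot>\<^bsub>C\<^esub> q i) = \<pi> i \<cdot>\<^bsub>C\<^esub> a i" if i: "i \<in> I" for i
  proof -
    note q = coprojection_hom[OF W i]
    have "f \<cdot>\<^bsub>C\<^esub> (h \<cdot>\<^bsub>C\<^esub> q i) = p \<cdot>\<^bsub>C\<^esub> (k \<cdot>\<^bsub>C\<^esub> q i)"
      using Comp_assoc[OF q h(1) f] Comp_assoc[OF q k p(1)] pk by simp
    also have "\<dots> = \<pi> i \<cdot>\<^bsub>C\<^esub> a i"
      using kq[OF i] Comp_assoc[OF a[OF i] coprojection_hom[OF S i] p(1)] p(2)[OF i] by simp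
    finally show ?thesis
      using a[OF i] dom[OF i] homD(2)[OF Comp_hom[OF q h(1)]] by simp
  qed
  then show "\<exists>(J :: nat set) \<pi>'. finite J \<and> effective_epi_family C J \<pi>' B' \<and>
      (\<forall>j \<in> J. \<exists>i \<in> I. \<exists>k \<in> hom C (Dom C (\<pi>' j)) (Dom C (\<pi> i)). f \<cdot>\<^bsub>C\<^esub> \<pi>' j = \<pi> i \<cdot>\<^bsub>C\<^esub> k)"
    using fin effective_epi_family_of_coproduct[OF assms(3) fin W h] by blast
qed

end
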